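(* Let $G$ be a bipartite optimal graph in $\mathfrak{B}_{n,m}$ which is a difference graph with vertex-eigenvector $(x_1,x_2,\ldots,x_k;y_1,y_2,\ldots,y_k)$, where $k\ge 3$. Suppose that $\sum_{i=1}^{k}x_i\ge\sum_{j=1}^{k-1}y_j$. Then $x_1\ge y_1+y_2$.
   Context: All graphs are finite, simple and undirected. For a graph $G$ on $n$ vertices with adjacency matrix $\mathbf{A}(G)$, write $\det(\lambda I-\mathbf{A}(G))=\sum_{i=0}^n \mathbf{a}_i(G)\lambda^{n-i}$, so $\mathbf{a}_4(G)$ is the coefficient of $\lambda^{n-4}$. $\mathfrak{B}_{n,m}$ is the set of connected bipartite graphs with $n$ vertices and $m$ edges; $G\in\mathfrak{B}_{n,m}$ is bipartite optimal if $\mathbf{a}_4(G)=\min\{\mathbf{a}_4(H):H\in\mathfrak{B}_{n,m}\}$. A difference graph with vertex bipartition $(X_1,\ldots,X_k;Y_1,\ldots,Y_k)$ is a graph whose vertex set is the disjoint union of nonempty sets $X_1,\ldots,X_k,Y_1,\ldots,Y_k$ and in which $x\in X_i$ and $y\in Y_j$ are adjacent if and only if $i+j\le k+1$, with no other edges. Its vertex-eigenvector is $(x_1,\ldots,x_k;y_1,\ldots,y_k)$ with $x_i=|X_i|$, $y_i=|Y_i|$. *)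

theory Defs
  imports
    "Graph_Theory.Pair_Digraph"
    "Graph_Theory.Digraph_Component"
    "Jordan_Normal_Form.Char_Poly"
begin

text \<open>
  A finite simple undirected graph is a \<^locale>\<open>pair_graph\<close>: a finite, symmetric, loop-free
  digraph without parallel arcs. Each undirected edge is represented by its two opposite arcs,
  so the number of edges is \<open>card (edges G)\<close>, not \<open>card (parcs G)\<close>.
\<close>

definition edges :: "'a pair_pre_digraph \<Rightarrow> 'a set set" where
  "edges G = {{u, v} | u v. (u, v) \<in> parcs G}"

definition bipartite :: "'a pair_pre_digraph \<Rightarrow> bool" where
  "bipartite G \<longleftrightarrow> (\<exists>U V. pverts G = U \<union> V \<and> U \<inter> V = {} \<and>
     parcs G \<subseteq> (U \<times> V) \<union> (V \<times> U))"

text \<open>The list \<open>vs\<close> is meant to enumerate the vertices of \<open>G\<close> without repetition.\<close>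

definition adjacency_matrix :: "'a list \<Rightarrow> 'a pair_pre_digraph \<Rightarrow> int mat" where
  "adjacency_matrix vs G =
     mat (length vs) (length vs) (\<lambda>(i, j). if (vs ! i, vs ! j) \<in> parcs G then 1 else 0)"

text \<open>
  By \<open>graph_coeff_eq\<close> below, the chosen enumeration is immaterial. The index \<open>i\<close> is intended to be
  at most the number of vertices (the subtraction on natural numbers truncates).
\<close>

definition graph_coeff :: "nat \<Rightarrow> 'a pair_pre_digraph \<Rightarrow> int" where
  "graph_coeff i G =
     coeff (char_poly (adjacency_matrix (SOME vs. distinct vs \<and> set vs = pverts G) G))
       (card (pverts G) - i)"

text \<open>
  The vertices are taken from an arbitrary but fixed type \<open>'a\<close>. As soon as \<open>'a\<close> has at least \<open>n\<close>
  elements, every isomorphism class of connected bipartite graphs with \<open>n\<close> vertices and \<open>m\<close>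
  edges is represented.
\<close>

definition connected_bipartite_graphs :: "nat \<Rightarrow> nat \<Rightarrow> 'a pair_pre_digraph set" where
  "connected_bipartite_graphs n m =
     {G. pair_graph G \<and> Digraph_Component.connected (with_proj G) \<and> bipartite G \<and>
         card (pverts G) = n \<and> card (edges G) = m}"

definition bipartite_optimal :: "nat \<Rightarrow> nat \<Rightarrow> 'a pair_pre_digraph \<Rightarrow> bool" where
  "bipartite_optimal n m G \<longleftrightarrow>
     G \<in> connected_bipartite_graphs n m \<and>
     (\<forall>H :: 'a pair_pre_digraph \<in> connected_bipartite_graphs n m. graph_coeff 4 G \<le> graph_coeff 4 H)"

text \<open>The families \<open>X\<close> and \<open>Y\<close> matter only at the indices \<open>1, \<dots>, k\<close>.\<close>

definition difference_graph ::
  "nat \<Rightarrow> (nat \<Rightarrow> 'a set) \<Rightarrow> (nat \<Rightarrow> 'a set) \<Rightarrow> 'a pair_pre_digraph \<Rightarrow> bool" where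
  "difference_graph k X Y G \<longleftrightarrow>
     pair_graph G \<and>
     (\<forall>i\<in>{1..k}. X i \<noteq> {} \<and> Y i \<noteq> {}) \<and>
     disjoint_family_on X {1..k} \<and> disjoint_family_on Y {1..k} \<and>
     (\<Union>i\<in>{1..k}. X i) \<inter> (\<Union>j\<in>{1..k}. Y j) = {} \<and>
     pverts G = (\<Union>i\<in>{1..k}. X i) \<union> (\<Union>j\<in>{1..k}. Y j) \<and>
     (\<forall>u v. (u, v) \<in> parcs G \<longleftrightarrow>
        (\<exists>i\<in>{1..k}. \<exists>j\<in>{1..k}. i + j \<le> k + 1 \<and>
           (u \<in> X i \<and> v \<in> Y j \<or> u \<in> Y j \<and> v \<in> X i)))"

definition difference_graph_with_eigenvector ::
  "nat \<Rightarrow> (nat \<Rightarrow> nat) \<Rightarrow> (nat \<Rightarrow> nat) \<Rightarrow> 'a pair_pre_digraph \<Rightarrow> bool" where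
  "difference_graph_with_eigenvector k x y G \<longleftrightarrow>
     (\<exists>X Y. difference_graph k X Y G \<and>
        (\<forall>i\<in>{1..k}. x i = card (X i) \<and> y i = card (Y i)))"

lemma char_poly_adjacency_matrix_enum:
  assumes "distinct vs" "distinct ws" "set vs = set ws"
  shows "char_poly (adjacency_matrix vs G) = char_poly (adjacency_matrix ws G)"
proof -
  define n where "n = length vs"
  have lw: "length ws = n"
    using assms by (metis distinct_card n_def)
  have ex: "\<exists>j<n. ws ! j = vs ! i" if "i < n" for i
    using that assms(3) lw by (metis in_set_conv_nth n_def)
  define p where "p i = (SOME j. j < n \<and> ws ! j = vs ! i)" for i
  have p: "p i < n" "ws ! p i = vs ! i" if "i < n" for i
    using someI_ex[OF ex[OF that, folded]] unfolding p_def by auto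
  have ex2: "\<exists>j<n. vs ! j = ws ! i" if "i < n" for i
    using that assms(3) lw by (metis in_set_conv_nth n_def)
  define q where "q i = (SOME j. j < n \<and> vs ! j = ws ! i)" for i
  have q: "q i < n" "vs ! q i = ws ! i" if "i < n" for i
    using someI_ex[OF ex2[OF that]] unfolding q_def by auto
  have pq: "p i = j \<longleftrightarrow> i = q j" if "i < n" "j < n" for i j
    using p[OF that(1)] q[OF that(2)] that assms lw n_def by (metis nth_eq_iff_index_eq)
  have qp: "q (p i) = i" if "i < n" for i using pq p that by metis
  have pq': "p (q i) = i" if "i < n" for i using pq q that by metis
  define P :: "int mat" where "P = mat n n (\<lambda>(i, j). if j = p i then 1 else 0)"
  define Q :: "int mat" where "Q = mat n n (\<lambda>(i, j). if j = q i then 1 else 0)"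
  have P: "P \<in> carrier_mat n n" and Q: "Q \<in> carrier_mat n n"
    by (auto simp: P_def Q_def)
  have L: "(mat n n (\<lambda>(i, j). if j = r i then 1 else 0) :: int mat) * M
      = mat n n (\<lambda>(i, j). M $$ (r i, j))"
    if M: "M \<in> carrier_mat n n" and r: "\<And>i. i < n \<Longrightarrow> r i < n" for M :: "int mat" and r
  proof (rule eq_matI)
    fix i j assume "i < dim_row (mat n n (\<lambda>(i, j). M $$ (r i, j)))"
      "j < dim_col (mat n n (\<lambda>(i, j). M $$ (r i, j)))"
    then have ij: "i < n" "j < n" by auto
    then have "((mat n n (\<lambda>(i, j). if j = r i then 1 else 0) :: int mat) * M) $$ (i, j)
      = (\<Sum>l = 0..<n. (if l = r i then 1 else 0) * M $$ (l, j))"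
      using M by (auto simp: scalar_prod_def intro!: sum.cong)
    also have "\<dots> = (\<Sum>l = 0..<n. if l = r i then M $$ (l, j) else 0)"
      by (rule sum.cong) auto
    also have "\<dots> = M $$ (r i, j)"
      using r[OF ij(1)] by (simp add: sum.delta)
    finally show "((mat n n (\<lambda>(i, j). if j = r i then 1 else 0) :: int mat) * M) $$ (i, j)
      = mat n n (\<lambda>(i, j). M $$ (r i, j)) $$ (i, j)" using ij by simp
  qed (use M in auto)
  have PL: "P * M = mat n n (\<lambda>(i, j). M $$ (p i, j))" if "M \<in> carrier_mat n n" for M
    unfolding P_def by (rule L) (use that p in auto)
  have QL: "Q * M = mat n n (\<lambda>(i, j). M $$ (q i, j))" if "M \<in> carrier_mat n n" for M
    unfolding Q_def by (rule L) (use that q in auto)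
  have PQ: "P * Q = 1\<^sub>m n"
    unfolding PL[OF Q] by (rule eq_matI) (auto simp: Q_def p qp)
  have QP: "Q * P = 1\<^sub>m n"
    unfolding QL[OF P] by (rule eq_matI) (auto simp: P_def q pq')
  define A where "A = adjacency_matrix vs G"
  define B where "B = adjacency_matrix ws G"
  have A: "A \<in> carrier_mat n n" and B: "B \<in> carrier_mat n n"
    by (auto simp: A_def B_def adjacency_matrix_def n_def lw[unfolded n_def])
  have "P * B = A * P"
  proof (rule eq_matI)
    fix i j assume "i < dim_row (A * P)" "j < dim_col (A * P)"
    then have ij: "i < n" "j < n" using A P by auto
    have "(A * P) $$ (i, j) = (\<Sum>l = 0..<n. A $$ (i, l) * (if j = p l then 1 else 0))"
      using ij A by (auto simp: scalar_prod_def P_def intro!: sum.cong)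
    also have "\<dots> = (\<Sum>l = 0..<n. if l = q j then A $$ (i, l) else 0)"
      using pq'[OF ij(2)] by (intro sum.cong) (auto simp: qp)
    also have "\<dots> = A $$ (i, q j)" using q[OF ij(2)] by (simp add: sum.delta)
    also have "\<dots> = B $$ (p i, j)"
      using ij p[OF ij(1)] q[OF ij(2)]
      by (simp add: A_def B_def adjacency_matrix_def lw n_def[symmetric])
    also have "\<dots> = (P * B) $$ (i, j)"
      unfolding PL[OF B] using ij by simp
    finally show "(P * B) $$ (i, j) = (A * P) $$ (i, j)" by simp
  qed (use A B P in auto)
  then have "P * B * Q = A * (P * Q)" using A P Q by simp
  then have "A = P * B * Q" using PQ A by simp
  then have "similar_mat_wit A B P Q"
    using PQ QP A B P Q by (intro similar_mat_witI[of _ _ n]) auto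
  then show ?thesis
    unfolding A_def[symmetric] B_def[symmetric] by (intro char_poly_similar) (auto simp: similar_mat_def)
qed

lemma graph_coeff_eq:
  assumes "distinct vs" "set vs = pverts G"
  shows "graph_coeff i G = coeff (char_poly (adjacency_matrix vs G)) (card (pverts G) - i)"
proof -
  let ?P = "\<lambda>vs. distinct vs \<and> set vs = pverts G"
  have "?P (SOME vs. ?P vs)" using assms by (intro someI[of ?P vs]) simp
  then show ?thesis
    unfolding graph_coeff_def
    using char_poly_adjacency_matrix_enum[of "SOME vs. ?P vs" vs G] assms by auto
qed

end

theory Submission
  imports Defs "Jordan_Normal_Form.Schur_Decomposition"
begin

text \<open>
  For a bipartite graph with \<open>m\<close> edges the odd power sums of the eigenvalues vanish, so Newton's
  identities give \<open>8 a\<^sub>4 = (2 m)\<^sup>2 - 2 w\<close> with \<open>w\<close> the number of closed walks of length four: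
  optimal means that \<open>w\<close> is maximal. Vertices \<open>S \<subseteq> V\<close> with common neighbourhood \<open>N\<close> can be
  moved to the other side of the bipartition, where they are given a neighbourhood
  \<open>M \<subseteq> V - S\<close> of the same size; this preserves \<open>n\<close> and \<open>m\<close> and changes \<open>w\<close> by a simple
  amount.

  In a difference graph, moving all of \<open>X\<^sub>k\<close>, or a single vertex of \<open>Y\<^sub>k\<close>, shows that
  \<open>y\<^sub>1 \<le> x\<^sub>1 \<le> y\<^sub>1 + y\<^sub>2\<close> is impossible for an optimal graph, and symmetrically for
  \<open>x\<^sub>1 \<le> y\<^sub>1 \<le> x\<^sub>1 + x\<^sub>2\<close>. So if \<open>x\<^sub>1 < y\<^sub>1 + y\<^sub>2\<close>, then \<open>x\<^sub>1 + x\<^sub>2 < y\<^sub>1\<close>. Now move all of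
  \<open>Y\<^sub>k\<close>: the hypothesis on the sums says that \<open>w\<close> does not decrease, so the result is again
  optimal, but there the role of \<open>(x\<^sub>1, y\<^sub>1, y\<^sub>1 + y\<^sub>2)\<close> is played by
  \<open>(x\<^sub>1 + x\<^sub>2, x\<^sub>1, y\<^sub>1)\<close>, which is impossible.
\<close>

section \<open>Traces and coefficients of the characteristic polynomial\<close>

definition trace :: "'a::comm_monoid_add mat \<Rightarrow> 'a" where
  "trace A = (\<Sum>i<dim_row A. A $$ (i, i))"

lemma trace_mult:
  assumes "A \<in> carrier_mat n m" "B \<in> carrier_mat m n"
  shows "trace (A * B) = (\<Sum>i<n. \<Sum>j<m. A $$ (i, j) * B $$ (j, i))"
  using assms by (auto simp: trace_def scalar_prod_def atLeast0LessThan intro!: sum.cong)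

lemma trace_mult_comm:
  fixes A B :: "'a::comm_semiring_0 mat"
  assumes "A \<in> carrier_mat n m" "B \<in> carrier_mat m n"
  shows "trace (A * B) = trace (B * A)"
  unfolding trace_mult[OF assms] trace_mult[OF assms(2,1)]
  by (subst sum.swap) (simp add: mult.commute)

lemma trace_similar:
  fixes A B :: "'a::comm_ring_1 mat"
  assumes "A \<in> carrier_mat n n" "similar_mat_wit A B P Q"
  shows "trace A = trace B"
proof -
  note w = similar_mat_witD2[OF assms]
  have "trace A = trace (P * (B * Q))" using w by simp
  also have "\<dots> = trace (B * Q * P)"
    using w by (intro trace_mult_comm[of _ n n]) auto
  also have "B * Q * P = B" using w by simp
  finally show ?thesis .
qed

section \<open>Power sums of eigenvalues as traces of matrix powers\<close>

lemma upper_triangular_mult: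
  fixes A B :: "'a::semiring_0 mat"
  assumes A: "A \<in> carrier_mat n n" "upper_triangular A"
    and B: "B \<in> carrier_mat n n" "upper_triangular B"
  shows "upper_triangular (A * B)"
    and "i < n \<Longrightarrow> (A * B) $$ (i, i) = A $$ (i, i) * B $$ (i, i)"
proof -
  \<comment> \<open>If \<open>l < i\<close>, the first factor lies below the diagonal; otherwise
    \<open>j < l\<close>, and the second one does.\<close>
  have zero: "A $$ (i, l) * B $$ (l, j) = 0" if "i < n" "l < n" "j \<le> i" "l \<noteq> i \<or> j < i" for i j l
  proof (cases "l < i")
    case True
    then show ?thesis using that A by (auto simp: upper_triangularD)
  next
    case False
    then have "B $$ (l, j) = 0" using that B by (intro upper_triangularD) auto
    then show ?thesis by simp
  qed
  show "upper_triangular (A * B)"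
  proof (rule upper_triangularI)
    fix i j assume "j < i" "i < dim_row (A * B)"
    then show "(A * B) $$ (i, j) = 0"
      using A B zero[of i _ j] by (auto simp: scalar_prod_def intro!: sum.neutral)
  qed
  assume i: "i < n"
  then have "(A * B) $$ (i, i) = (\<Sum>l = 0..<n. A $$ (i, l) * B $$ (l, i))"
    using A B by (auto simp: scalar_prod_def)
  also have "\<dots> = (\<Sum>l = 0..<n. if l = i then A $$ (i, i) * B $$ (i, i) else 0)"
    using i zero[of i _ i] by (intro sum.cong) auto
  finally show "(A * B) $$ (i, i) = A $$ (i, i) * B $$ (i, i)" using i by simp
qed

lemma upper_triangular_pow:
  fixes A :: "'a::comm_semiring_1 mat"
  assumes "A \<in> carrier_mat n n" "upper_triangular A"
  shows "upper_triangular (A ^\<^sub>m k) \<and> (\<forall>i<n. (A ^\<^sub>m k) $$ (i, i) = A $$ (i, i) ^ k)"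
proof (induction k)
  case 0
  then show ?case using assms by auto
next
  case (Suc k)
  then show ?case
    using upper_triangular_mult[OF pow_carrier_mat[OF assms(1)] _ assms, of k]
    by (auto simp: mult.commute)
qed

text \<open>Schur triangularisation puts exactly \<open>es\<close>, with multiplicity, on the
  diagonal, and powers of a triangular matrix act entrywise there.\<close>

lemma trace_pow_eigenvalues:
  fixes A :: "complex mat"
  assumes A: "A \<in> carrier_mat n n" and es: "char_poly A = (\<Prod>e\<leftarrow>es. [:- e, 1:])"
  shows "trace (A ^\<^sub>m k) = (\<Sum>e\<leftarrow>es. e ^ k)"
proof -
  obtain B P Q where dec: "schur_decomposition A es = (B, P, Q)"
    by (metis prod_cases3)
  from schur_decomposition[OF A es dec]
  have sim: "similar_mat_wit A B P Q" and ut: "upper_triangular B" and d: "diag_mat B = es"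
    by auto
  have B: "B \<in> carrier_mat n n" using similar_mat_witD2[OF A sim] by simp
  have "trace (A ^\<^sub>m k) = trace (B ^\<^sub>m k)"
    using similar_mat_wit_pow[OF sim] A by (intro trace_similar[of _ n]) (auto intro: pow_carrier_mat)
  also have "\<dots> = (\<Sum>i<n. B $$ (i, i) ^ k)"
    using upper_triangular_pow[OF B ut] B by (auto simp: trace_def intro!: sum.cong)
  also have "\<dots> = (\<Sum>e\<leftarrow>diag_mat B. e ^ k)"
    using B by (simp add: diag_mat_def sum_list_distinct_conv_sum_set comp_def atLeast0LessThan)
  finally show ?thesis by (simp add: d)
qed

text \<open>The values \<open>c k\<close> are the signed elementary symmetric polynomials of
  \<open>es\<close>: these are Newton's identities, cleared of denominators so that they hold in any
  commutative ring. A new root \<open>a\<close> replaces \<open>c (Suc k)\<close> by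
  \<open>c (Suc k) - a * c k\<close>, which drives the induction.\<close>

lemma newton_coeffs:
  fixes es :: "'a::comm_ring_1 list"
  defines "p \<equiv> (\<lambda>k. \<Sum>e\<leftarrow>es. e ^ k)" and "c \<equiv> coeff (\<Prod>e\<leftarrow>es. [:1, - e:])"
  shows "c 0 = 1 \<and> c 1 = - p 1 \<and> 2 * c 2 = p 1 ^ 2 - p 2 \<and>
    6 * c 3 = - (p 1 ^ 3) + 3 * p 1 * p 2 - 2 * p 3 \<and>
    24 * c 4 = p 1 ^ 4 - 6 * p 1 ^ 2 * p 2 + 3 * p 2 ^ 2 + 8 * p 1 * p 3 - 6 * p 4"
  unfolding p_def c_def
proof (induction es)
  case Nil
  then show ?case by (simp add: coeff_1)
next
  case (Cons a es)
  define P where "P = (\<Prod>e\<leftarrow>es. [:1, - e:])"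
  have s: "coeff (\<Prod>e\<leftarrow>a # es. [:1, - e:]) (Suc k) = coeff P (Suc k) - a * coeff P k" for k
    by (simp add: P_def mult_pCons_left)
  have z: "coeff (\<Prod>e\<leftarrow>a # es. [:1, - e:]) 0 = coeff P 0"
    by (simp add: P_def)
  have n: "1 = Suc 0" "2 = Suc 1" "3 = Suc 2" "4 = Suc 3" by auto
  note IH = Cons.IH[folded P_def]
  define s1 s2 s3 s4 where "s1 = (\<Sum>e\<leftarrow>es. e ^ 1)" and "s2 = (\<Sum>e\<leftarrow>es. e ^ 2)"
    and "s3 = (\<Sum>e\<leftarrow>es. e ^ 3)" and "s4 = (\<Sum>e\<leftarrow>es. e ^ 4)"
  define c0 c1 c2 c3 c4 where "c0 = coeff P 0" and "c1 = coeff P 1" and "c2 = coeff P 2"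
    and "c3 = coeff P 3" and "c4 = coeff P 4"
  have eqs: "c0 = 1" "c1 = - s1" "2 * c2 = s1 ^ 2 - s2"
    "6 * c3 = - (s1 ^ 3) + 3 * s1 * s2 - 2 * s3"
    "24 * c4 = s1 ^ 4 - 6 * s1 ^ 2 * s2 + 3 * s2 ^ 2 + 8 * s1 * s3 - 6 * s4"
    using IH by (auto simp: s1_def s2_def s3_def s4_def c0_def c1_def c2_def c3_def c4_def)
  have cs: "coeff (\<Prod>e\<leftarrow>a # es. [:1, - e:]) 1 = c1 - a * c0"
    "coeff (\<Prod>e\<leftarrow>a # es. [:1, - e:]) 2 = c2 - a * c1"
    "coeff (\<Prod>e\<leftarrow>a # es. [:1, - e:]) 3 = c3 - a * c2"
    "coeff (\<Prod>e\<leftarrow>a # es. [:1, - e:]) 4 = c4 - a * c3"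
    using s[of 0] s[of 1] s[of 2] s[of 3]
    unfolding c0_def c1_def c2_def c3_def c4_def n[symmetric] by auto
  have ps: "(\<Sum>e\<leftarrow>a # es. e ^ 1) = a + s1" "(\<Sum>e\<leftarrow>a # es. e ^ 2) = a ^ 2 + s2"
    "(\<Sum>e\<leftarrow>a # es. e ^ 3) = a ^ 3 + s3" "(\<Sum>e\<leftarrow>a # es. e ^ 4) = a ^ 4 + s4"
    by (simp_all add: s1_def s2_def s3_def s4_def)
  have "2 * (c2 - a * c1) = 2 * c2 - 2 * a * c1" by (simp add: algebra_simps)
  then have e2: "2 * (c2 - a * c1) = (a + s1) ^ 2 - (a ^ 2 + s2)"
    unfolding eqs by (simp add: algebra_simps power2_eq_square)
  have "6 * (c3 - a * c2) = 6 * c3 - 3 * a * (2 * c2)" by (simp add: algebra_simps)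
  then have e3: "6 * (c3 - a * c2)
      = - ((a + s1) ^ 3) + 3 * (a + s1) * (a ^ 2 + s2) - 2 * (a ^ 3 + s3)"
    unfolding eqs by (simp add: algebra_simps power2_eq_square power3_eq_cube)
  have "24 * (c4 - a * c3) = 24 * c4 - 4 * a * (6 * c3)" by (simp add: algebra_simps)
  then have e4: "24 * (c4 - a * c3)
      = (a + s1) ^ 4 - 6 * (a + s1) ^ 2 * (a ^ 2 + s2) + 3 * (a ^ 2 + s2) ^ 2
        + 8 * (a + s1) * (a ^ 3 + s3) - 6 * (a ^ 4 + s4)"
    unfolding eqs by (simp add: algebra_simps power2_eq_square power3_eq_cube power4_eq_xxxx)
  show ?case
    unfolding cs ps using e2 e3 e4 eqs(1,2) z c0_def by simp
qed

text \<open>Reversal turns the coefficient four below the top of a characteristic polynomial into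
  coefficient 4 of a product covered by \<open>newton_coeffs\<close>.\<close>

lemma reflect_poly_prod_roots:
  fixes es :: "'a::idom list"
  shows "reflect_poly (\<Prod>e\<leftarrow>es. [:- e, 1:]) = (\<Prod>e\<leftarrow>es. [:1, - e:])"
  by (induction es) (simp_all add: reflect_poly_mult reflect_poly_def[of "[:_, 1:]"] del: mult_pCons_left)

text \<open>The complex numbers supply the eigenvalues. With the first and third power sums zero,
  the fourth Newton identity is three times the claim.\<close>

lemma coeff_char_poly_trace:
  fixes A :: "int mat"
  assumes A: "A \<in> carrier_mat n n" and n: "n \<ge> 4"
    and t: "trace A = 0" "trace (A ^\<^sub>m 3) = 0"
  shows "8 * coeff (char_poly A) (n - 4) = trace (A ^\<^sub>m 2) ^ 2 - 2 * trace (A ^\<^sub>m 4)"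
proof -
  define C :: "complex mat" where "C = map_mat of_int A"
  have C: "C \<in> carrier_mat n n" using A by (simp add: C_def)
  obtain es where es: "char_poly C = (\<Prod>e\<leftarrow>es. [:- e, 1:])" and len: "length es = n"
    using char_poly_factorized[OF C] by auto
  have cp: "char_poly C = map_poly of_int (char_poly A)"
    unfolding C_def by (rule of_int_hom.char_poly_hom[OF A])
  have tr: "(\<Sum>e\<leftarrow>es. e ^ k) = of_int (trace (A ^\<^sub>m k))" for k
  proof -
    have "C ^\<^sub>m k = map_mat of_int (A ^\<^sub>m k)"
      unfolding C_def by (rule of_int_hom.mat_hom_pow[OF A, symmetric])
    then show ?thesis
      using trace_pow_eigenvalues[OF C es, of k] A by (simp add: trace_def)
  qed
  have t1: "trace (A ^\<^sub>m 1) = 0" using t(1) A by simp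
  have "degree (char_poly C) = n" using degree_monic_char_poly[OF C] by simp
  then have "coeff (reflect_poly (char_poly C)) 4 = of_int (coeff (char_poly A) (n - 4))"
    using n by (simp add: coeff_reflect_poly cp)
  then have "coeff (\<Prod>e\<leftarrow>es. [:1, - e:]) 4 = of_int (coeff (char_poly A) (n - 4))"
    by (simp add: es reflect_poly_prod_roots)
  moreover have "24 * coeff (\<Prod>e\<leftarrow>es. [:1, - e:]) 4
      = 3 * of_int (trace (A ^\<^sub>m 2)) ^ 2 - 6 * of_int (trace (A ^\<^sub>m 4))"
    using newton_coeffs[of es] unfolding tr t1 t(2) by simp
  ultimately have "(of_int (24 * coeff (char_poly A) (n - 4)) :: complex)
      = of_int (3 * trace (A ^\<^sub>m 2) ^ 2 - 6 * trace (A ^\<^sub>m 4))"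
    by simp
  then have "24 * coeff (char_poly A) (n - 4) = 3 * trace (A ^\<^sub>m 2) ^ 2 - 6 * trace (A ^\<^sub>m 4)"
    unfolding of_int_eq_iff .
  then show ?thesis by simp
qed

section \<open>Closed walks of length four in bipartite graphs\<close>

definition nbhd :: "'a pair_pre_digraph \<Rightarrow> 'a \<Rightarrow> 'a set" where
  "nbhd G v = {w. (v, w) \<in> parcs G}"

definition codegree :: "'a pair_pre_digraph \<Rightarrow> 'a \<Rightarrow> 'a \<Rightarrow> nat" where
  "codegree G u v = card (nbhd G u \<inter> nbhd G v)"

text \<open>The square counts ordered pairs of middle vertices on a walk from \<open>u\<close> to
  \<open>v\<close> and back, so the sum is the trace of the fourth power of the adjacency
  matrix.\<close>

definition closed_4_walks :: "'a pair_pre_digraph \<Rightarrow> nat" where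
  "closed_4_walks G = (\<Sum>u\<in>pverts G. \<Sum>v\<in>pverts G. (codegree G u v)\<^sup>2)"

text \<open>The sides are named, unlike in \<open>bipartite\<close>, because moving vertices changes
  them and the walk counts refer to a single side.\<close>

definition bipartition :: "'a pair_pre_digraph \<Rightarrow> 'a set \<Rightarrow> 'a set \<Rightarrow> bool" where
  "bipartition G U V \<longleftrightarrow> pair_graph G \<and> pverts G = U \<union> V \<and> U \<inter> V = {} \<and>
     parcs G \<subseteq> (U \<times> V) \<union> (V \<times> U)"

section \<open>Neighbourhoods and edge counts in a bipartition\<close>

lemma bipartition_commute: "bipartition G U V \<Longrightarrow> bipartition G V U"
  by (auto simp: bipartition_def)

lemma bipartition_finite:
  assumes "bipartition G U V"
  shows "finite U" "finite V"
  using assms pair_fin_digraph.pair_finite_verts[of G]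
  by (auto simp: bipartition_def pair_graph_def pair_digraph_def)

lemma bipartition_sym:
  assumes "bipartition G U V"
  shows "(u, v) \<in> parcs G \<longleftrightarrow> (v, u) \<in> parcs G"
proof -
  have "symmetric (with_proj G)"
    using assms pair_sym_digraph.pair_sym_arcs
    by (auto simp: bipartition_def pair_graph_def pair_pseudo_graph_def)
  then show ?thesis by (auto simp: symmetric_def sym_def)
qed

lemma bipartition_nbhd:
  assumes "bipartition G U V" "v \<in> V"
  shows "nbhd G v \<subseteq> U"
  using assms by (auto simp: bipartition_def nbhd_def)

lemma bipartition_nbhd_disjoint:
  assumes "bipartition G U V" "u \<in> U" "v \<in> V"
  shows "nbhd G u \<inter> nbhd G v = {}"
proof -
  have "nbhd G u \<subseteq> V" "nbhd G v \<subseteq> U" "U \<inter> V = {}"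
    using assms bipartition_nbhd[OF assms(1,3)]
      bipartition_nbhd[OF bipartition_commute[OF assms(1)] assms(2)]
    by (auto simp: bipartition_def)
  then show ?thesis by blast
qed

lemma bipartitionI:
  assumes "finite U" "finite V" "pverts G = U \<union> V" "U \<inter> V = {}"
    "parcs G \<subseteq> (U \<times> V) \<union> (V \<times> U)" "\<And>u v. (u, v) \<in> parcs G \<Longrightarrow> (v, u) \<in> parcs G"
  shows "bipartition G U V"
proof -
  have "finite (parcs G)"
    using assms by (meson finite_UnI finite_SigmaI finite_subset)
  then have "pair_graph G"
    using assms by unfold_locales (auto simp: symmetric_def sym_def)
  then show ?thesis using assms by (simp add: bipartition_def)
qed

text \<open>Every edge has exactly one orientation from \<open>U\<close> to
  \<open>V\<close>.\<close>

lemma card_edges_bipartition: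
  assumes "bipartition G U V"
  shows "card (edges G) = card (parcs G \<inter> (U \<times> V))"
proof -
  have "edges G = (\<lambda>(u, v). {u, v}) ` (parcs G \<inter> (U \<times> V))"
  proof (intro equalityI subsetI)
    fix e assume "e \<in> edges G"
    then obtain u v where e: "e = {u, v}" "(u, v) \<in> parcs G" by (auto simp: edges_def)
    then consider "(u, v) \<in> U \<times> V" | "(v, u) \<in> U \<times> V" "(v, u) \<in> parcs G"
      using assms bipartition_sym[OF assms] by (fastforce simp: bipartition_def)
    then show "e \<in> (\<lambda>(u, v). {u, v}) ` (parcs G \<inter> (U \<times> V))"
    proof cases
      case 1
      then show ?thesis using e by force
    next
      case 2
      then have "(\<lambda>(u, v). {u, v}) (v, u) \<in> (\<lambda>(u, v). {u, v}) ` (parcs G \<inter> (U \<times> V))" by blast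
      then show ?thesis using e by (simp add: insert_commute)
    qed
  qed (auto simp: edges_def)
  moreover have "inj_on (\<lambda>(u, v). {u, v}) (parcs G \<inter> (U \<times> V))"
    using assms by (auto simp: bipartition_def inj_on_def doubleton_eq_iff)
  ultimately show ?thesis by (simp add: card_image)
qed

lemma card_parcs_bipartition:
  assumes "bipartition G U V"
  shows "card (parcs G) = 2 * card (edges G)"
proof -
  have "parcs G = parcs G \<inter> (U \<times> V) \<union> parcs G \<inter> (V \<times> U)"
    using assms by (auto simp: bipartition_def)
  moreover have "(parcs G \<inter> (U \<times> V)) \<inter> (parcs G \<inter> (V \<times> U)) = {}"
    using assms by (auto simp: bipartition_def)
  ultimately have "card (parcs G) = card (parcs G \<inter> (U \<times> V)) + card (parcs G \<inter> (V \<times> U))"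
    using bipartition_finite[OF assms] by (metis card_Un_disjoint finite_Int finite_SigmaI)
  then show ?thesis
    using card_edges_bipartition[OF assms] card_edges_bipartition[OF bipartition_commute[OF assms]]
    by simp
qed

lemma sum_nth_distinct:
  assumes "distinct vs"
  shows "(\<Sum>i<length vs. f (vs ! i)) = (\<Sum>v\<in>set vs. f v)"
  using sum.reindex_bij_betw[OF bij_betw_nth[OF assms refl refl], of f] .

text \<open>The squared adjacency matrix has the codegrees as entries, so the traces of the second
  and fourth powers are the degree sum and \<open>closed_4_walks\<close>, while the traces of the
  first and third powers vanish.\<close>

lemma graph_coeff_4_bipartition:
  assumes bp: "bipartition G U V" and n: "card (pverts G) \<ge> 4"
  shows "8 * graph_coeff 4 G = (2 * int (card (edges G)))\<^sup>2 - 2 * int (closed_4_walks G)"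
proof -
  have fin: "finite (pverts G)" using bp bipartition_finite[OF bp] by (simp add: bipartition_def)
  then obtain vs where vs: "distinct vs" "set vs = pverts G"
    using finite_distinct_list by blast
  define l where "l = length vs"
  have l: "card (pverts G) = l" using vs distinct_card l_def by metis
  define A where "A = adjacency_matrix vs G"
  have A: "A \<in> carrier_mat l l" by (simp add: A_def adjacency_matrix_def l_def)
  have nb: "nbhd G v \<subseteq> pverts G" for v
    using bp by (auto simp: bipartition_def nbhd_def)
  have A2: "(A * A) $$ (i, j) = int (codegree G (vs ! i) (vs ! j))" if "i < l" "j < l" for i j
  proof -
    have "(A * A) $$ (i, j) = (\<Sum>k<l. A $$ (i, k) * A $$ (k, j))"
      using that A by (auto simp: scalar_prod_def atLeast0LessThan)
    also have "\<dots> = (\<Sum>k<l. of_bool (vs ! k \<in> nbhd G (vs ! i) \<inter> nbhd G (vs ! j)))"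
      using that bipartition_sym[OF bp]
      by (intro sum.cong) (auto simp: A_def adjacency_matrix_def l_def nbhd_def)
    also have "\<dots> = (\<Sum>v\<in>pverts G. of_bool (v \<in> nbhd G (vs ! i) \<inter> nbhd G (vs ! j)))"
      unfolding l_def vs(2)[symmetric] by (rule sum_nth_distinct[OF vs(1),
        of "\<lambda>v. of_bool (v \<in> nbhd G (vs ! i) \<inter> nbhd G (vs ! j))"])
    also have "\<dots> = int (card (pverts G \<inter> (nbhd G (vs ! i) \<inter> nbhd G (vs ! j))))"
      by (subst sum_of_bool_eq) (simp_all only: Collect_mem_eq fin)
    also have "pverts G \<inter> (nbhd G (vs ! i) \<inter> nbhd G (vs ! j)) = nbhd G (vs ! i) \<inter> nbhd G (vs ! j)"
      using nb by blast
    finally show ?thesis by (simp add: codegree_def)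
  qed
  have loopfree: "(v, v) \<notin> parcs G" for v using bp by (auto simp: bipartition_def)
  have "trace A = 0"
    using loopfree by (auto simp: trace_def A_def adjacency_matrix_def)
  \<comment> \<open>Adjacent vertices lie on opposite sides and share no neighbour.\<close>
  moreover have "trace (A ^\<^sub>m 3) = 0"
  proof -
    have "trace (A ^\<^sub>m 3) = trace (A * A * A)" using A by (simp add: numeral_3_eq_3)
    also have "\<dots> = (\<Sum>i<l. \<Sum>j<l. (A * A) $$ (i, j) * A $$ (j, i))"
      using A by (intro trace_mult) auto
    also have "\<dots> = 0"
    proof (intro sum.neutral ballI)
      fix i j assume ij: "i \<in> {..<l}" "j \<in> {..<l}"
      have "nbhd G (vs ! i) \<inter> nbhd G (vs ! j) = {}" if "(vs ! j, vs ! i) \<in> parcs G"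
      proof -
        have "vs ! j \<in> U \<and> vs ! i \<in> V \<or> vs ! j \<in> V \<and> vs ! i \<in> U"
          using that bp by (auto simp: bipartition_def)
        then show ?thesis using bipartition_nbhd_disjoint[OF bp] by blast
      qed
      then show "(A * A) $$ (i, j) * A $$ (j, i) = 0"
        using ij by (subst A2) (auto simp: A_def adjacency_matrix_def l_def codegree_def)
    qed
    finally show ?thesis .
  qed
  moreover have "trace (A ^\<^sub>m 2) = 2 * int (card (edges G))"
  proof -
    have "trace (A ^\<^sub>m 2) = trace (A * A)" using A by (simp add: numeral_2_eq_2)
    also have "\<dots> = (\<Sum>i<l. int (codegree G (vs ! i) (vs ! i)))"
      using A A2 by (auto simp: trace_def)
    also have "\<dots> = (\<Sum>v\<in>pverts G. int (codegree G v v))"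
      unfolding l_def vs(2)[symmetric]
      by (rule sum_nth_distinct[OF vs(1), of "\<lambda>v. int (codegree G v v)"])
    also have "\<dots> = int (card (SIGMA v:pverts G. nbhd G v))"
      using fin finite_subset[OF nb fin] by (subst card_SigmaI) (auto simp: codegree_def)
    also have "(SIGMA v:pverts G. nbhd G v) = parcs G"
      using bp by (auto simp: bipartition_def nbhd_def)
    finally show ?thesis using card_parcs_bipartition[OF bp] by simp
  qed
  moreover have "trace (A ^\<^sub>m 4) = int (closed_4_walks G)"
  proof -
    have "A ^\<^sub>m 4 = A * A * A * A" using A by (simp add: eval_nat_numeral)
    also have "\<dots> = (A * A) * (A * A)" using A by (simp add: assoc_mult_mat[of _ l l _ l _ l])
    finally have "trace (A ^\<^sub>m 4) = trace ((A * A) * (A * A))" by simp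
    also have "\<dots> = (\<Sum>i<l. \<Sum>j<l. (A * A) $$ (i, j) * (A * A) $$ (j, i))"
      using A by (intro trace_mult) auto
    also have "\<dots> = (\<Sum>i<l. \<Sum>j<l. (int (codegree G (vs ! i) (vs ! j)))\<^sup>2)"
      using A2 by (intro sum.cong) (auto simp: power2_eq_square codegree_def Int_commute)
    also have "\<dots> = (\<Sum>i<l. \<Sum>v\<in>pverts G. (int (codegree G (vs ! i) v))\<^sup>2)"
      unfolding l_def vs(2)[symmetric] by (intro sum.cong refl
        sum_nth_distinct[OF vs(1), of "\<lambda>v. (int (codegree G (vs ! _) v))\<^sup>2"])
    also have "\<dots> = (\<Sum>u\<in>pverts G. \<Sum>v\<in>pverts G. (int (codegree G u v))\<^sup>2)"
      using sum_nth_distinct[OF vs(1), of "\<lambda>u. \<Sum>v\<in>pverts G. (int (codegree G u v))\<^sup>2"]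
      by (simp only: l_def vs(2))
    finally show ?thesis by (simp add: closed_4_walks_def)
  qed
  moreover have "graph_coeff 4 G = coeff (char_poly A) (l - 4)"
    using graph_coeff_eq[OF vs, of 4] by (simp add: A_def l)
  ultimately show ?thesis
    using coeff_char_poly_trace[OF A] n l by simp
qed

text \<open>Both sides count the closed walks of length four in the bipartite graph \<open>R\<close>.\<close>

lemma sum_codegree_sq_swap:
  assumes "finite A" "finite B"
  shows "(\<Sum>a\<in>A. \<Sum>a'\<in>A. (card {b\<in>B. R a b \<and> R a' b})\<^sup>2)
    = (\<Sum>b\<in>B. \<Sum>b'\<in>B. (card {a\<in>A. R a b \<and> R a b'})\<^sup>2)"
proof -
  \<comment> \<open>With 0/1 indicators both sides expand to the same fourfold sum, up to the order
    of summation.\<close>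
  define r :: "'a \<Rightarrow> 'b \<Rightarrow> nat" where "r a b = of_bool (R a b)" for a b
  have c1: "card {b\<in>B. R a b \<and> R a' b} = (\<Sum>b\<in>B. r a b * r a' b)" for a a'
    using assms by (simp add: r_def of_bool_conj[symmetric] sum_of_bool_eq Int_def)
  have c2: "card {a\<in>A. R a b \<and> R a b'} = (\<Sum>a\<in>A. r a b * r a b')" for b b'
    using assms by (simp add: r_def of_bool_conj[symmetric] sum_of_bool_eq Int_def)
  have "(\<Sum>a\<in>A. \<Sum>a'\<in>A. (card {b\<in>B. R a b \<and> R a' b})\<^sup>2)
      = (\<Sum>a\<in>A. \<Sum>a'\<in>A. \<Sum>b\<in>B. \<Sum>b'\<in>B. r a b * r a' b * (r a b' * r a' b'))"
    unfolding c1 power2_eq_square sum_product ..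
  also have "\<dots> = (\<Sum>a\<in>A. \<Sum>b\<in>B. \<Sum>a'\<in>A. \<Sum>b'\<in>B. r a b * r a' b * (r a b' * r a' b'))"
    by (intro sum.cong refl sum.swap)
  also have "\<dots> = (\<Sum>b\<in>B. \<Sum>a\<in>A. \<Sum>b'\<in>B. \<Sum>a'\<in>A. r a b * r a' b * (r a b' * r a' b'))"
    by (subst sum.swap) (intro sum.cong refl sum.swap)
  also have "\<dots> = (\<Sum>b\<in>B. \<Sum>b'\<in>B. \<Sum>a\<in>A. \<Sum>a'\<in>A. r a b * r a' b * (r a b' * r a' b'))"
    by (intro sum.cong refl sum.swap)
  also have "\<dots> = (\<Sum>b\<in>B. \<Sum>b'\<in>B. (card {a\<in>A. R a b \<and> R a b'})\<^sup>2)"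
    unfolding c2 power2_eq_square sum_product by (intro sum.cong refl) (simp add: ac_simps)
  finally show ?thesis .
qed

text \<open>Codegrees across the sides vanish, and both sides contribute equally by
  \<open>sum_codegree_sq_swap\<close>.\<close>

lemma closed_4_walks_bipartition:
  assumes bp: "bipartition G U V"
  shows "closed_4_walks G = 2 * (\<Sum>v\<in>V. \<Sum>v'\<in>V. (codegree G v v')\<^sup>2)"
proof -
  note fin = bipartition_finite[OF bp]
  have pv: "pverts G = U \<union> V" "U \<inter> V = {}" using bp by (auto simp: bipartition_def)
  have cross: "codegree G u v = 0" "codegree G v u = 0" if "u \<in> U" "v \<in> V" for u v
    using bipartition_nbhd_disjoint[OF bp that] by (simp_all add: codegree_def Int_commute)
  have "(\<Sum>u\<in>U. \<Sum>u'\<in>U. (codegree G u u')\<^sup>2)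
      = (\<Sum>u\<in>U. \<Sum>u'\<in>U. (card {v\<in>V. (u, v) \<in> parcs G \<and> (u', v) \<in> parcs G})\<^sup>2)"
    using bp by (intro sum.cong refl arg_cong[where f = "\<lambda>x. x\<^sup>2"])
      (auto simp: codegree_def nbhd_def bipartition_def intro!: arg_cong[where f = card])
  also have "\<dots> = (\<Sum>v\<in>V. \<Sum>v'\<in>V. (card {u\<in>U. (u, v) \<in> parcs G \<and> (u, v') \<in> parcs G})\<^sup>2)"
    by (rule sum_codegree_sq_swap[OF fin])
  also have "\<dots> = (\<Sum>v\<in>V. \<Sum>v'\<in>V. (codegree G v v')\<^sup>2)"
    using bp bipartition_sym[OF bp] by (intro sum.cong refl arg_cong[where f = "\<lambda>x. x\<^sup>2"])
      (auto simp: codegree_def nbhd_def bipartition_def intro!: arg_cong[where f = card])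
  finally show ?thesis
    using fin pv cross by (simp add: closed_4_walks_def sum.union_disjoint)
qed

text \<open>Vertices of \<open>V\<close> are adjacent to \<open>x\<close>; those of \<open>U\<close>
  reach \<open>x\<close> through \<open>y\<close>.\<close>

lemma connected_dominating_pair:
  assumes bp: "bipartition G U V"
    and x: "x \<in> U" "V \<subseteq> nbhd G x" and y: "y \<in> V" "U \<subseteq> nbhd G y"
  shows "Digraph_Component.connected (with_proj G)"
proof -
  let ?R = "rtrancl_on (pverts G) ((parcs G)\<^sup>s)"
  have pv: "pverts G = U \<union> V" using bp by (auto simp: bipartition_def)
  have step: "(a, b) \<in> ?R" if "(a, b) \<in> parcs G \<or> (b, a) \<in> parcs G" for a b
  proof (rule rtrancl_on_into_rtrancl_on)
    show "(a, a) \<in> ?R" "b \<in> pverts G" using that bp by (auto simp: bipartition_def)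
    show "(a, b) \<in> (parcs G)\<^sup>s" using that by (auto simp: symcl_def)
  qed
  have to: "(v, x) \<in> ?R" "(x, v) \<in> ?R" if "v \<in> pverts G" for v
  proof -
    have yx: "(y, x) \<in> ?R" "(x, y) \<in> ?R" using x y by (auto simp: nbhd_def intro: step)
    have "(v, x) \<in> ?R \<and> (x, v) \<in> ?R"
    proof (cases "v \<in> V")
      case True
      then show ?thesis using x by (auto simp: nbhd_def intro: step)
    next
      case False
      then have "(y, v) \<in> parcs G" using that pv y by (auto simp: nbhd_def)
      then have "(v, y) \<in> ?R" "(y, v) \<in> ?R" by (simp_all add: step)
      then show ?thesis
        using rtrancl_on_trans[of v y] rtrancl_on_trans[of x y] yx by blast
    qed
    then show "(v, x) \<in> ?R" "(x, v) \<in> ?R" by auto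
  qed
  show ?thesis
    unfolding connected_conv with_proj_simps
  proof (intro conjI ballI)
    show "pverts G \<noteq> {}" using pv x by auto
    fix u v assume "u \<in> pverts G" "v \<in> pverts G"
    then show "(u, v) \<in> ?R" using rtrancl_on_trans[OF to(1) to(2)] by simp
  qed
qed

section \<open>Moving vertices across the bipartition\<close>

text \<open>The vertex set stays the same; only the arcs record the change of side.\<close>

definition transfer_vertices ::
  "'a pair_pre_digraph \<Rightarrow> 'a set \<Rightarrow> 'a set \<Rightarrow> 'a pair_pre_digraph" where
  "transfer_vertices G S M = \<lparr>pverts = pverts G,
     parcs = {(u, v) \<in> parcs G. u \<notin> S \<and> v \<notin> S} \<union> S \<times> M \<union> M \<times> S\<rparr>"

lemma pverts_transfer_vertices [simp]: "pverts (transfer_vertices G S M) = pverts G"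
  by (simp add: transfer_vertices_def)

lemma nbhd_transfer_vertices:
  assumes "S \<inter> M = {}"
  shows "nbhd (transfer_vertices G S M) v =
    (if v \<in> S then M else nbhd G v - S \<union> (if v \<in> M then S else {}))"
  using assms by (auto simp: transfer_vertices_def nbhd_def)

locale vertex_transfer =
  fixes G :: "'a pair_pre_digraph" and U V S N M :: "'a set"
  assumes bipartition: "bipartition G U V"
    and S: "S \<subseteq> V" "\<And>s. s \<in> S \<Longrightarrow> nbhd G s = N"
    and M: "M \<subseteq> V - S" "card M = card N"
    and N: "N \<subseteq> U"
begin

abbreviation "H \<equiv> transfer_vertices G S M"

lemma disj: "S \<inter> M = {}" using M by blast

lemma finite_sides: "finite U" "finite V" "finite S" "finite (V - S)"
  using bipartition_finite[OF bipartition] S finite_subset by auto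

lemma bipartition_transfer: "bipartition H (U \<union> S) (V - S)"
proof (rule bipartitionI)
  show "finite (U \<union> S)" "finite (V - S)" using finite_sides by auto
  show "pverts H = U \<union> S \<union> (V - S)" "(U \<union> S) \<inter> (V - S) = {}"
    "parcs H \<subseteq> (U \<union> S) \<times> (V - S) \<union> (V - S) \<times> (U \<union> S)"
    using bipartition S M by (auto simp: bipartition_def transfer_vertices_def)
  show "(v, u) \<in> parcs H" if "(u, v) \<in> parcs H" for u v
    using that bipartition_sym[OF bipartition, of u v] by (auto simp: transfer_vertices_def)
qed

text \<open>The edges \<open>K\<close> away from \<open>S\<close> are untouched; the others form
  \<open>N \<times> S\<close> before and \<open>S \<times> M\<close> after the move.\<close>

lemma card_edges_transfer: "card (edges H) = card (edges G)"
proof -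
  define K where "K = parcs G \<inter> (U \<times> (V - S))"
  have "(u, s) \<in> parcs G \<longleftrightarrow> u \<in> N" if "s \<in> S" for u s
    using S(2)[OF that] bipartition_sym[OF bipartition, of u s] by (auto simp: nbhd_def)
  then have "parcs G \<inter> (U \<times> V) = K \<union> N \<times> S"
    using S(1) N by (auto simp: K_def)
  moreover have "K \<inter> N \<times> S = {}" by (auto simp: K_def)
  moreover have "finite K" using finite_sides by (simp add: K_def)
  moreover have "finite (N \<times> S)" using finite_sides N finite_subset by blast
  ultimately have G: "card (edges G) = card K + card N * card S"
    using card_edges_bipartition[OF bipartition] by (simp add: card_Un_disjoint card_cartesian_product)
  have "parcs H \<inter> ((U \<union> S) \<times> (V - S)) = K \<union> S \<times> M"
    using S M bipartition by (auto simp: K_def transfer_vertices_def bipartition_def)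
  moreover have "K \<inter> S \<times> M = {}" using bipartition S by (auto simp: K_def bipartition_def)
  moreover have "finite K" using finite_sides by (simp add: K_def)
  moreover have "finite (S \<times> M)" using finite_sides M finite_subset by blast
  ultimately have "card (edges H) = card K + card S * card M"
    using card_edges_bipartition[OF bipartition_transfer]
    by (simp add: card_Un_disjoint card_cartesian_product)
  then show ?thesis using G M by simp
qed

text \<open>Counting the codegrees inside \<open>V\<close> for \<open>G\<close> and inside \<open>U \<union> S\<close> for \<open>H\<close>, only the
  pairs with exactly one member in \<open>S\<close> contribute differently: the pairs inside \<open>S\<close> contribute
  the same since \<open>card M = card N\<close>, the other pairs by double counting in \<open>G - S\<close>.\<close>

lemma closed_4_walks_transfer:
  "closed_4_walks H + 4 * card S * (\<Sum>v\<in>V - S. (card (N \<inter> nbhd G v))\<^sup>2)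
    = closed_4_walks G + 4 * card S * (\<Sum>u\<in>U. (card (M \<inter> nbhd G u))\<^sup>2)"
proof -
  \<comment> \<open>Stated for an arbitrary graph, since it is applied both to \<open>G\<close> on
    \<open>(V - S) \<union> S\<close> and to \<open>H\<close> on \<open>U \<union> S\<close>. Mixed
    pairs occur in both orders, whence the factor 2.\<close>
  have split: "(\<Sum>v\<in>A \<union> B. \<Sum>v'\<in>A \<union> B. (codegree F v v')\<^sup>2)
    = (\<Sum>v\<in>A. \<Sum>v'\<in>A. (codegree F v v')\<^sup>2) + 2 * card B * (\<Sum>v\<in>A. (card (L \<inter> nbhd F v))\<^sup>2)
      + (card B * card L)\<^sup>2"
    if fin: "finite A" "finite B" "A \<inter> B = {}" and L: "\<And>b. b \<in> B \<Longrightarrow> nbhd F b = L"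
    for F :: "'a pair_pre_digraph" and A B L
  proof -
    have "(\<Sum>v\<in>A. \<Sum>v'\<in>B. (codegree F v v')\<^sup>2) = card B * (\<Sum>v\<in>A. (card (L \<inter> nbhd F v))\<^sup>2)"
      using L by (simp add: codegree_def Int_commute sum_distrib_left)
    moreover have "(\<Sum>v\<in>B. \<Sum>v'\<in>A. (codegree F v v')\<^sup>2) = card B * (\<Sum>v\<in>A. (card (L \<inter> nbhd F v))\<^sup>2)"
      using L by (simp add: codegree_def)
    moreover have "(\<Sum>v\<in>B. \<Sum>v'\<in>B. (codegree F v v')\<^sup>2) = (card B * card L)\<^sup>2"
      using L by (simp add: codegree_def power2_eq_square)
    ultimately show ?thesis
      using fin by (simp add: sum.union_disjoint sum.distrib algebra_simps)
  qed
  have V: "V = (V - S) \<union> S" using S by blast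
  have nU: "nbhd G u \<subseteq> V" if "u \<in> U" for u
    using bipartition_nbhd[OF bipartition_commute[OF bipartition] that] .
  have nV: "nbhd G v \<subseteq> U" if "v \<in> V" for v
    using bipartition_nbhd[OF bipartition that] .
  have UV: "U \<inter> V = {}" using bipartition by (auto simp: bipartition_def)
  have nH: "nbhd H u = nbhd G u - S" if "u \<in> U" for u
    using that UV S M by (auto simp: nbhd_transfer_vertices[OF disj])
  have "(\<Sum>u\<in>U. \<Sum>u'\<in>U. (codegree H u u')\<^sup>2)
      = (\<Sum>u\<in>U. \<Sum>u'\<in>U. (card {v\<in>V - S. v \<in> nbhd G u \<and> v \<in> nbhd G u'})\<^sup>2)"
    using nU by (intro sum.cong refl arg_cong[where f = "\<lambda>x. x\<^sup>2"])
      (auto simp: codegree_def nH intro!: arg_cong[where f = card])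
  also have "\<dots> = (\<Sum>v\<in>V - S. \<Sum>v'\<in>V - S. (card {u\<in>U. v \<in> nbhd G u \<and> v' \<in> nbhd G u})\<^sup>2)"
    using finite_sides by (intro sum_codegree_sq_swap) auto
  also have "\<dots> = (\<Sum>v\<in>V - S. \<Sum>v'\<in>V - S. (codegree G v v')\<^sup>2)"
  proof (intro sum.cong refl arg_cong[where f = "\<lambda>x. x\<^sup>2"])
    fix v v' assume "v \<in> V - S" "v' \<in> V - S"
    then have "{u\<in>U. v \<in> nbhd G u \<and> v' \<in> nbhd G u} = nbhd G v \<inter> nbhd G v'"
      using nV[of v] bipartition_sym[OF bipartition] by (auto simp: nbhd_def)
    then show "card {u\<in>U. v \<in> nbhd G u \<and> v' \<in> nbhd G u} = codegree G v v'"
      by (simp add: codegree_def)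
  qed
  finally have common: "(\<Sum>u\<in>U. \<Sum>u'\<in>U. (codegree H u u')\<^sup>2)
    = (\<Sum>v\<in>V - S. \<Sum>v'\<in>V - S. (codegree G v v')\<^sup>2)" .
  have "M \<inter> nbhd H u = M \<inter> nbhd G u" if "u \<in> U" for u
    using nH[OF that] M by blast
  then have rows: "(\<Sum>u\<in>U. (card (M \<inter> nbhd H u))\<^sup>2) = (\<Sum>u\<in>U. (card (M \<inter> nbhd G u))\<^sup>2)"
    by (intro sum.cong) auto
  have "closed_4_walks G = 2 * (\<Sum>v\<in>(V - S) \<union> S. \<Sum>v'\<in>(V - S) \<union> S. (codegree G v v')\<^sup>2)"
    using closed_4_walks_bipartition[OF bipartition] V by simp
  also have "\<dots> = 2 * ((\<Sum>v\<in>V - S. \<Sum>v'\<in>V - S. (codegree G v v')\<^sup>2)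
      + 2 * card S * (\<Sum>v\<in>V - S. (card (N \<inter> nbhd G v))\<^sup>2) + (card S * card N)\<^sup>2)"
    using finite_sides S by (subst split[of "V - S" S G N]) auto
  finally have G: "closed_4_walks G = \<dots>" .
  have "closed_4_walks H = 2 * (\<Sum>v\<in>U \<union> S. \<Sum>v'\<in>U \<union> S. (codegree H v v')\<^sup>2)"
    using closed_4_walks_bipartition[OF bipartition_commute[OF bipartition_transfer]] .
  also have "\<dots> = 2 * ((\<Sum>u\<in>U. \<Sum>u'\<in>U. (codegree H u u')\<^sup>2)
      + 2 * card S * (\<Sum>u\<in>U. (card (M \<inter> nbhd H u))\<^sup>2) + (card S * card M)\<^sup>2)"
    using finite_sides S UV
    by (subst split[of U S H M]) (auto simp: nbhd_transfer_vertices[OF disj])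
  finally have "closed_4_walks H = \<dots>" .
  then show ?thesis
    unfolding G common rows M(2) by (simp add: algebra_simps)
qed

text \<open>Optimality forbids a gain of closed walks, which orders the two correction terms of
  \<open>closed_4_walks_transfer\<close>; if they agree, \<open>H\<close> has the same coefficient
  and inherits optimality. The vertices \<open>x\<close> and \<open>y\<close> keep \<open>H\<close>
  connected: \<open>y\<close> lies in \<open>M\<close> and so also sees \<open>S\<close>.\<close>

lemma optimal_transfer:
  assumes opt: "bipartite_optimal n m G" and n: "n \<ge> 4"
    and x: "x \<in> U" "V - S \<subseteq> nbhd G x" and y: "y \<in> M" "U \<subseteq> nbhd G y" and "S \<noteq> {}"
  shows "(\<Sum>u\<in>U. (card (M \<inter> nbhd G u))\<^sup>2) \<le> (\<Sum>v\<in>V - S. (card (N \<inter> nbhd G v))\<^sup>2)"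
    and "(\<Sum>u\<in>U. (card (M \<inter> nbhd G u))\<^sup>2) = (\<Sum>v\<in>V - S. (card (N \<inter> nbhd G v))\<^sup>2)
      \<Longrightarrow> bipartite_optimal n m H"
proof -
  have UV: "U \<inter> V = {}" using bipartition by (auto simp: bipartition_def)
  have G: "card (pverts G) = n" "card (edges G) = m"
    using opt by (auto simp: bipartite_optimal_def connected_bipartite_graphs_def)
  have "Digraph_Component.connected (with_proj H)"
  proof (rule connected_dominating_pair[OF bipartition_transfer])
    show "x \<in> U \<union> S" "y \<in> V - S" using x y M by auto
    show "V - S \<subseteq> nbhd H x" "U \<union> S \<subseteq> nbhd H y"
      using x y M S UV by (auto simp: nbhd_transfer_vertices[OF disj])
  qed
  then have H: "H \<in> connected_bipartite_graphs n m"
    using bipartition_transfer card_edges_transfer G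
    unfolding connected_bipartite_graphs_def bipartite_def bipartition_def by auto
  then have le: "graph_coeff 4 G \<le> graph_coeff 4 H"
    using opt by (simp add: bipartite_optimal_def)
  have coeffs: "8 * graph_coeff 4 G = (2 * int m)\<^sup>2 - 2 * int (closed_4_walks G)"
    "8 * graph_coeff 4 H = (2 * int m)\<^sup>2 - 2 * int (closed_4_walks H)"
    using graph_coeff_4_bipartition[OF bipartition] graph_coeff_4_bipartition[OF bipartition_transfer]
      G n card_edges_transfer by auto
  have "card S > 0" using \<open>S \<noteq> {}\<close> finite_sides by (simp add: card_gt_0_iff)
  have "closed_4_walks H \<le> closed_4_walks G" using le coeffs by linarith
  then have "4 * card S * (\<Sum>u\<in>U. (card (M \<inter> nbhd G u))\<^sup>2)
      \<le> 4 * card S * (\<Sum>v\<in>V - S. (card (N \<inter> nbhd G v))\<^sup>2)"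
    using closed_4_walks_transfer by linarith
  then show "(\<Sum>u\<in>U. (card (M \<inter> nbhd G u))\<^sup>2) \<le> (\<Sum>v\<in>V - S. (card (N \<inter> nbhd G v))\<^sup>2)"
    using \<open>card S > 0\<close> by simp
  assume "(\<Sum>u\<in>U. (card (M \<inter> nbhd G u))\<^sup>2) = (\<Sum>v\<in>V - S. (card (N \<inter> nbhd G v))\<^sup>2)"
  then have "closed_4_walks H = closed_4_walks G" using closed_4_walks_transfer by simp
  then have "graph_coeff 4 H = graph_coeff 4 G" using coeffs by simp
  then show "bipartite_optimal n m H" using opt H by (simp add: bipartite_optimal_def)
qed

end

section \<open>Optimal difference graphs\<close>

text \<open>The two competing moves: turning all rows \<open>R\<close> into columns forces \<open>card V \<le> card (U - R)\<close>,
  and turning one column \<open>s \<in> S\<close> into a row forces \<open>card (U - R) < card V\<close>.\<close>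

lemma not_optimal_if_between:
  assumes opt: "bipartite_optimal n m G" and n: "n \<ge> 4" and bp: "bipartition G U V"
    and R: "R \<subseteq> U" "R \<noteq> {}" "\<And>r. r \<in> R \<Longrightarrow> nbhd G r = B"
    and S: "S \<subseteq> V" "S \<noteq> {}" "\<And>s. s \<in> S \<Longrightarrow> nbhd G s = A"
    and A: "\<And>v. v \<in> V \<Longrightarrow> A \<subseteq> nbhd G v" "A \<inter> R = {}"
    and B: "\<And>u. u \<in> U \<Longrightarrow> B \<subseteq> nbhd G u" "B \<noteq> {}"
    and C: "\<And>u. u \<in> U - R \<Longrightarrow> C \<subseteq> nbhd G u" "B \<subseteq> C" "C \<inter> S = {}"
    and card: "card B \<le> card A" "card A \<le> card C"
  shows False
proof -
  note fin = bipartition_finite[OF bp]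
  have AU: "A \<subseteq> U" using S bipartition_nbhd[OF bp] by blast
  have BV: "B \<subseteq> V" using R bipartition_nbhd[OF bipartition_commute[OF bp]] by blast
  have finAB: "finite A" "finite B" using AU BV fin finite_subset by auto
  have b: "card B > 0" using B finAB by (simp add: card_gt_0_iff)
  then have "A \<noteq> {}" using card by auto
  have dA: "V \<subseteq> nbhd G a" if "a \<in> A" for a
    using A(1) that bipartition_sym[OF bp] by (fastforce simp: nbhd_def)
  have dB: "U \<subseteq> nbhd G b" if "b \<in> B" for b
    using B(1) that bipartition_sym[OF bp] by (fastforce simp: nbhd_def)
  obtain a where a: "a \<in> A" using \<open>A \<noteq> {}\<close> by blast
  obtain b where b': "b \<in> B" using B by blast
  have CV: "C \<subseteq> V"
    using a A(2) AU C(1)[of a] bipartition_nbhd[OF bipartition_commute[OF bp], of a] by blast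
  have "card V \<le> card (U - R)"
  proof -
    \<comment> \<open>Every column is adjacent to all of \<open>A\<close>, so with \<open>M\<close>
      inside \<open>A\<close> all terms on both sides equal the square of
      \<open>card B\<close>.\<close>
    obtain M where M: "M \<subseteq> A" "card M = card B" using card obtain_subset_with_card_n by metis
    have "M \<noteq> {}" using M b by auto
    then obtain y where y: "y \<in> M" by blast
    interpret T: vertex_transfer G V U R B M
      using bipartition_commute[OF bp] R M A(2) AU BV by unfold_locales auto
    have "(\<Sum>v\<in>V. (card (M \<inter> nbhd G v))\<^sup>2) \<le> (\<Sum>u\<in>U - R. (card (B \<inter> nbhd G u))\<^sup>2)"
      using T.optimal_transfer(1)[OF opt n, of b y] b' dB y dA M R BV by blast
    moreover have "M \<inter> nbhd G v = M" if "v \<in> V" for v using A(1)[OF that] M by blast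
    moreover have "B \<inter> nbhd G u = B" if "u \<in> U" for u using B(1)[OF that] by blast
    ultimately have "card V * (card B)\<^sup>2 \<le> card (U - R) * (card B)\<^sup>2"
      using M by simp
    then show ?thesis using b by simp
  qed
  moreover have "card (U - R) < card V"
  proof -
    obtain s where s: "s \<in> S" using S by blast
    \<comment> \<open>\<open>B \<subseteq> M\<close> provides a vertex adjacent to all of
      \<open>U\<close>, for connectedness; \<open>M \<subseteq> C\<close> makes every row outside
      \<open>R\<close> contribute fully.\<close>
    obtain M where M: "B \<subseteq> M" "M \<subseteq> C" "card M = card A"
      using exists_subset_between[OF card C(2)] CV fin finite_subset by metis
    interpret T: vertex_transfer G U V "{s}" A M
      using bp S s M AU CV C(3) by unfold_locales auto
    have "(\<Sum>u\<in>U. (card (M \<inter> nbhd G u))\<^sup>2) \<le> (\<Sum>v\<in>V - {s}. (card (A \<inter> nbhd G v))\<^sup>2)"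
      using T.optimal_transfer(1)[OF opt n, of a b] a dA AU b' dB M by blast
    moreover have "A \<inter> nbhd G v = A" if "v \<in> V - {s}" for v using A(1)[of v] that by blast
    then have "(\<Sum>v\<in>V - {s}. (card (A \<inter> nbhd G v))\<^sup>2) = (\<Sum>v\<in>V - {s}. (card A)\<^sup>2)"
      by (intro sum.cong) auto
    moreover have "M \<inter> nbhd G u = M" if "u \<in> U - R" for u using C(1)[OF that] M by blast
    then have "(\<Sum>u\<in>U - R. (card (M \<inter> nbhd G u))\<^sup>2) = (\<Sum>u\<in>U - R. (card M)\<^sup>2)"
      by (intro sum.cong) auto
    \<comment> \<open>Rows in \<open>R\<close> may meet \<open>M\<close> only partly, so their terms
      are bounded below by zero.\<close>
    moreover have "(\<Sum>u\<in>U - R. (card (M \<inter> nbhd G u))\<^sup>2) \<le> (\<Sum>u\<in>U. (card (M \<inter> nbhd G u))\<^sup>2)"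
      using fin by (intro sum_mono2) auto
    ultimately have "(\<Sum>u\<in>U - R. (card M)\<^sup>2) \<le> (\<Sum>v\<in>V - {s}. (card A)\<^sup>2)"
      by linarith
    then have "card (U - R) * (card A)\<^sup>2 \<le> card (V - {s}) * (card A)\<^sup>2"
      using M by simp
    then have "card (U - R) \<le> card (V - {s})"
      using b card by simp
    \<comment> \<open>The one column lost by the move makes the inequality strict.\<close>
    moreover have "card (V - {s}) < card V"
      using s S fin by (intro psubset_card_mono) auto
    ultimately show ?thesis by simp
  qed
  ultimately show False by simp
qed

section \<open>Neighbourhoods and sizes of the blocks of a difference graph\<close>

lemma difference_graph_commute: "difference_graph k X Y G \<Longrightarrow> difference_graph k Y X G"
  unfolding difference_graph_def by (simp add: Int_commute Un_commute conj_commute) (metis add.commute)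

lemma difference_graph_bipartition:
  assumes "difference_graph k X Y G"
  shows "bipartition G (\<Union>i\<in>{1..k}. X i) (\<Union>j\<in>{1..k}. Y j)"
  using assms unfolding difference_graph_def bipartition_def by auto

lemma difference_graph_disjoint:
  assumes "difference_graph k X Y G" "i \<in> {1..k}" "j \<in> {1..k}"
  shows "i \<noteq> j \<Longrightarrow> X i \<inter> X j = {}" and "i \<noteq> j \<Longrightarrow> Y i \<inter> Y j = {}" and "X i \<inter> Y j = {}"
proof -
  have "disjoint_family_on X {1..k}" "disjoint_family_on Y {1..k}"
    "(\<Union>i\<in>{1..k}. X i) \<inter> (\<Union>j\<in>{1..k}. Y j) = {}"
    using assms(1) unfolding difference_graph_def by blast+
  then show "i \<noteq> j \<Longrightarrow> X i \<inter> X j = {}" "i \<noteq> j \<Longrightarrow> Y i \<inter> Y j = {}" "X i \<inter> Y j = {}"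
    using assms(2,3) unfolding disjoint_family_on_def by blast+
qed

text \<open>The blocks are disjoint, so \<open>i\<close> is the only index of \<open>u\<close>; the
  neighbourhoods form a chain, largest for \<open>X 1\<close>.\<close>

lemma difference_graph_nbhd:
  assumes G: "difference_graph k X Y G" and i: "i \<in> {1..k}" and u: "u \<in> X i"
  shows "nbhd G u = (\<Union>j\<in>{1..k + 1 - i}. Y j)"
proof -
  have "u \<in> X i' \<longleftrightarrow> i' = i" "u \<notin> Y i'" if "i' \<in> {1..k}" for i'
    using u difference_graph_disjoint[OF G that i] difference_graph_disjoint(3)[OF G i that] by auto
  moreover have "(u, v) \<in> parcs G \<longleftrightarrow> (\<exists>i\<in>{1..k}. \<exists>j\<in>{1..k}. i + j \<le> k + 1 \<and>
      (u \<in> X i \<and> v \<in> Y j \<or> u \<in> Y j \<and> v \<in> X i))" for v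
    using G unfolding difference_graph_def by blast
  ultimately have "(u, v) \<in> parcs G \<longleftrightarrow> (\<exists>j\<in>{1..k}. i + j \<le> k + 1 \<and> v \<in> Y j)" for v
    using i by blast
  moreover have "j \<in> {1..k + 1 - i} \<longleftrightarrow> j \<in> {1..k} \<and> i + j \<le> k + 1" for j
    using i by auto
  ultimately show ?thesis unfolding nbhd_def by blast
qed

lemma difference_graph_card:
  assumes G: "difference_graph k X Y G"
  shows "l \<le> k \<Longrightarrow> card (\<Union>i\<in>{1..l}. X i) = (\<Sum>i=1..l. card (X i))"
    and "k \<le> card (\<Union>i\<in>{1..k}. X i)"
proof -
  have fin: "finite (X i)" if "i \<in> {1..k}" for i
    using bipartition_finite(1)[OF difference_graph_bipartition[OF G]] that
    by (auto elim: finite_subset[rotated])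
  have c: "card (\<Union>i\<in>{1..l}. X i) = (\<Sum>i=1..l. card (X i))" if "l \<le> k" for l
  proof -
    have "X i \<inter> X j = {}" if "i \<in> {1..l}" "j \<in> {1..l}" "i \<noteq> j" for i j
      using difference_graph_disjoint(1)[OF G, of i j] that \<open>l \<le> k\<close> by auto
    then show ?thesis using fin that by (intro card_UN_disjoint) auto
  qed
  then show "card (\<Union>i\<in>{1..l}. X i) = (\<Sum>i=1..l. card (X i))" if "l \<le> k"
    using that .
  have "(\<Sum>i=1..k. 1) \<le> (\<Sum>i=1..k. card (X i))"
    using G fin by (intro sum_mono) (auto simp: difference_graph_def Suc_le_eq card_gt_0_iff)
  then show "k \<le> card (\<Union>i\<in>{1..k}. X i)" using c[of k] by simp
qed

text \<open>The last blocks \<open>X k\<close> and \<open>Y k\<close> have neighbourhoods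
  \<open>Y 1\<close> and \<open>X 1\<close>. All rows outside \<open>X k\<close> see
  \<open>Y 1 \<union> Y 2\<close>, which is disjoint from \<open>Y k\<close> because
  \<open>k \<ge> 3\<close>.\<close>

lemma not_optimal_difference_graph:
  assumes opt: "bipartite_optimal n m G" and n: "n \<ge> 4" and G: "difference_graph k X Y G"
    and k: "k \<ge> 3"
    and le: "card (Y 1) \<le> card (X 1)" "card (X 1) \<le> card (Y 1) + card (Y 2)"
  shows False
proof -
  let ?U = "\<Union>i\<in>{1..k}. X i" and ?V = "\<Union>j\<in>{1..k}. Y j"
  note bp = difference_graph_bipartition[OF G]
  note nX = difference_graph_nbhd[OF G]
  note nY = difference_graph_nbhd[OF difference_graph_commute[OF G]]
  have idx: "1 \<in> {1..k}" "2 \<in> {1..k}" "k \<in> {1..k}" using k by auto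
  note disj = difference_graph_disjoint[OF G]
  show False
  proof (rule not_optimal_if_between[OF opt n bp, of "X k" "Y 1" "Y k" "X 1" "Y 1 \<union> Y 2"])
    show "X k \<subseteq> ?U" "Y k \<subseteq> ?V" using idx(3) by blast+
    show "X k \<noteq> {}" "Y k \<noteq> {}" "Y 1 \<noteq> {}" using G idx by (auto simp: difference_graph_def)
    show "nbhd G r = Y 1" if "r \<in> X k" for r using nX[OF idx(3) that] by simp
    show "nbhd G s = X 1" if "s \<in> Y k" for s using nY[OF idx(3) that] by simp
    show "X 1 \<subseteq> nbhd G v" if "v \<in> ?V" for v using that nY by fastforce
    show "Y 1 \<subseteq> nbhd G u" if "u \<in> ?U" for u using that nX by fastforce
    show "Y 1 \<union> Y 2 \<subseteq> nbhd G u" if u: "u \<in> ?U - X k" for u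
    proof -
      obtain i where i: "i \<in> {1..k}" "u \<in> X i" "i \<noteq> k" using u by blast
      then have "1 \<in> {1..k + 1 - i}" "2 \<in> {1..k + 1 - i}" by auto
      then show ?thesis using nX[OF i(1,2)] by blast
    qed
    show "X 1 \<inter> X k = {}" using disj(1)[OF idx(1,3)] k by auto
    show "(Y 1 \<union> Y 2) \<inter> Y k = {}" using disj(2)[OF idx(1,3)] disj(2)[OF idx(2,3)] k by auto
    show "Y 1 \<subseteq> Y 1 \<union> Y 2" by simp
    show "card (Y 1) \<le> card (X 1)" by (rule le)
    have "finite (Y 1)" "finite (Y 2)"
      using bipartition_finite(2)[OF bp] idx by (auto elim: finite_subset[rotated])
    then show "card (X 1) \<le> card (Y 1 \<union> Y 2)"
      using le disj(2)[OF idx(1,2)] by (simp add: card_Un_disjoint)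
  qed
qed

theorem theorem4p7:
  fixes G :: "'a pair_pre_digraph" and n m k :: nat and x y :: "nat \<Rightarrow> nat"
  assumes "bipartite_optimal n m G"
    and "difference_graph_with_eigenvector k x y G"
    and "k \<ge> 3"
    and "(\<Sum>i=1..k. x i) \<ge> (\<Sum>j=1..k-1. y j)"
  shows "x 1 \<ge> y 1 + y 2"
proof (rule ccontr)
  assume lt: "\<not> x 1 \<ge> y 1 + y 2"
  obtain X Y where G: "difference_graph k X Y G"
    and xy: "\<And>i. i \<in> {1..k} \<Longrightarrow> x i = card (X i)" "\<And>i. i \<in> {1..k} \<Longrightarrow> y i = card (Y i)"
    using assms(2) by (auto simp: difference_graph_with_eigenvector_def)
  note opt = assms(1) and k = assms(3)
  let ?U = "\<Union>i\<in>{1..k}. X i" and ?V = "\<Union>j\<in>{1..k}. Y j"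
  note bp = difference_graph_bipartition[OF G]
  note G' = difference_graph_commute[OF G]
  note nX = difference_graph_nbhd[OF G] and nY = difference_graph_nbhd[OF G']
  have idx: "1 \<in> {1..k}" "2 \<in> {1..k}" "k \<in> {1..k}" "k - 1 \<in> {1..k}" using k by auto
  note disj = difference_graph_disjoint[OF G]
  have ne: "X i \<noteq> {}" "Y i \<noteq> {}" if "i \<in> {1..k}" for i
    using G that by (auto simp: difference_graph_def)
  have UV: "?U \<inter> ?V = {}" using bp by (auto simp: bipartition_def)
  have finX: "finite (X i)" if "i \<in> {1..k}" for i
    using bipartition_finite[OF bp] that by (auto elim: finite_subset[rotated])
  have "card ?U + card ?V = n"
    using opt bp bipartition_finite[OF bp]
    by (auto simp: bipartite_optimal_def connected_bipartite_graphs_def bipartition_def card_Un_disjoint)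
  \<comment> \<open>Blocks are nonempty, so each side has at least \<open>k \<ge> 3\<close>
    vertices.\<close>
  then have n: "n \<ge> 4"
    using difference_graph_card(2)[OF G] difference_graph_card(2)[OF G'] k by linarith
  have x1: "card (X 1) < card (Y 1) + card (Y 2)" using lt xy idx by simp
  then have "card (X 1) < card (Y 1)"
    using not_optimal_difference_graph[OF opt n G k] by (meson less_imp_le not_le)
  \<comment> \<open>With the sides exchanged, \<open>card (Y 1)\<close> cannot lie between
    \<open>card (X 1)\<close> and \<open>card (X 1) + card (X 2)\<close>.\<close>
  then have y1: "card (X 1) + card (X 2) \<le> card (Y 1)"
    using not_optimal_difference_graph[OF opt n G' k] by (meson less_imp_le not_le)
  \<comment> \<open>Inside \<open>Y 1\<close>, the new neighbourhood of \<open>Y k\<close> is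
    adjacent to all of \<open>?U\<close>.\<close>
  obtain M where M: "M \<subseteq> Y 1" "card M = card (X 1)"
    using y1 obtain_subset_with_card_n[of "card (X 1)" "Y 1"] by auto
  have "card (X 1) > 0" using ne(1)[OF idx(1)] finX[OF idx(1)] by (simp add: card_gt_0_iff)
  then have "M \<noteq> {}" using M by auto
  obtain a where a: "a \<in> X 1" using ne idx by blast
  obtain b where b: "b \<in> M" using \<open>M \<noteq> {}\<close> by blast
  have dX: "X 1 \<subseteq> nbhd G v" if "v \<in> ?V" for v using that nY by fastforce
  have dY: "Y 1 \<subseteq> nbhd G u" if "u \<in> ?U" for u using that nX by fastforce
  have VS: "?V - Y k = (\<Union>j\<in>{1..k - 1}. Y j)"
  proof -
    have "{1..k} = insert k {1..k - 1}" using k by auto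
    then have "?V = Y k \<union> (\<Union>j\<in>{1..k - 1}. Y j)" by simp
    moreover have "Y k \<inter> (\<Union>j\<in>{1..k - 1}. Y j) = {}" using disj(2)[OF idx(3)] k by fastforce
    ultimately show ?thesis by blast
  qed
  interpret T: vertex_transfer G ?U ?V "Y k" "X 1" M
  proof
    show "bipartition G ?U ?V" by (rule bp)
    show "Y k \<subseteq> ?V" "X 1 \<subseteq> ?U" using idx by blast+
    show "nbhd G s = X 1" if "s \<in> Y k" for s using nY[OF idx(3) that] by simp
    show "M \<subseteq> ?V - Y k" using M(1) disj(2)[OF idx(1,3)] k idx(1) by fastforce
    show "card M = card (X 1)" by (rule M)
  qed
  have ax: "a \<in> ?U" "?V - Y k \<subseteq> nbhd G a" using nX[OF idx(1) a] a idx(1) by (blast, auto)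
  have by': "?U \<subseteq> nbhd G b" using nY[OF idx(1), of b] b M(1) by auto
  note le = T.optimal_transfer[OF opt n ax b by' ne(2)[OF idx(3)]]
  have "M \<inter> nbhd G u = M" if "u \<in> ?U" for u using dY[OF that] M by blast
  then have s1: "(\<Sum>u\<in>?U. (card (M \<inter> nbhd G u))\<^sup>2) = card ?U * (card (X 1))\<^sup>2"
    using M by simp
  have "X 1 \<inter> nbhd G v = X 1" if "v \<in> ?V" for v using dX[OF that] by blast
  then have s2: "(\<Sum>v\<in>?V - Y k. (card (X 1 \<inter> nbhd G v))\<^sup>2) = card (?V - Y k) * (card (X 1))\<^sup>2"
    by simp
  have "card ?U = (\<Sum>i=1..k. x i)"
    using difference_graph_card(1)[OF G, of k] xy(1) by simp
  moreover have "card (?V - Y k) = (\<Sum>j=1..k-1. y j)"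
    unfolding VS using difference_graph_card(1)[OF G', of "k - 1"] xy(2) by (auto intro!: sum.cong)
  ultimately have "card (?V - Y k) \<le> card ?U" using assms(4) by simp
  \<comment> \<open>Optimality of \<open>G\<close> bounds the sum over \<open>?U\<close> by the sum
    over \<open>?V - Y k\<close>; the hypothesis on the sums gives the reverse bound, so equality
    holds.\<close>
  then have optH: "bipartite_optimal n m T.H"
    using le unfolding s1 s2 by (metis le_antisym mult_le_mono1)
  have MY: "M \<inter> Y k = {}" using T.disj by blast
  have nH: "nbhd T.H v = (if v \<in> Y k then M else nbhd G v - Y k \<union> (if v \<in> M then Y k else {}))" for v
    by (rule nbhd_transfer_vertices[OF T.disj])
  \<comment> \<open>\<open>T.H\<close> is again a difference graph, with eigenvector
    \<open>(x\<^sub>1 + x\<^sub>2, x\<^sub>3, \<dots>, x\<^sub>k, y\<^sub>k; x\<^sub>1, y\<^sub>1 - x\<^sub>1, y\<^sub>2, \<dots>, y\<^sub>k\<^sub>-\<^sub>1)\<close>.\<close>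
  have Ydisj: "Y 1 \<inter> Y k = {}" "Y 1 \<inter> Y (k - 1) = {}" "Y k \<inter> Y (k - 1) = {}"
    using k disj(2)[OF idx(1,3)] disj(2)[OF idx(1,4)] disj(2)[OF idx(3,4)] by linarith+
  \<comment> \<open>Vertices of \<open>Y (k - 1)\<close> see exactly the first two row
    blocks.\<close>
  have kk: "{1..k + 1 - (k - 1)} = {1, 2}" using k by auto
  show False
  \<comment> \<open>In \<open>T.H\<close> the last row block is \<open>Y k\<close> with
    neighbourhood \<open>M\<close>, and the last column block is \<open>Y (k - 1)\<close> with
    neighbourhood \<open>X 1 \<union> X 2\<close>; all other rows see \<open>Y 1\<close>.\<close>
  proof (rule not_optimal_if_between[OF optH n T.bipartition_transfer,
      of "Y k" M "Y (k - 1)" "X 1 \<union> X 2" "Y 1"])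
    show "Y k \<subseteq> ?U \<union> Y k" by simp
    show "Y k \<noteq> {}" "Y (k - 1) \<noteq> {}" "M \<noteq> {}" using ne idx \<open>M \<noteq> {}\<close> by auto
    show "nbhd T.H r = M" if "r \<in> Y k" for r using that by (simp add: nH)
    show "Y (k - 1) \<subseteq> ?V - Y k" using idx(4) Ydisj(3) by blast
    show "nbhd T.H s = X 1 \<union> X 2" if s: "s \<in> Y (k - 1)" for s
    proof -
      have "nbhd G s = X 1 \<union> X 2" using nY[OF idx(4) s] unfolding kk by simp
      moreover have "s \<notin> Y k" "s \<notin> M"
        using s M(1) Ydisj by blast+
      moreover have "(X 1 \<union> X 2) \<inter> Y k = {}" using UV idx by blast
      ultimately show ?thesis using nH[of s] by auto
    qed
    show "X 1 \<union> X 2 \<subseteq> nbhd T.H v" if v: "v \<in> ?V - Y k" for v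
    proof -
      obtain j where j: "j \<in> {1..k}" "v \<in> Y j" "j \<noteq> k" using v by blast
      then have "1 \<in> {1..k + 1 - j}" "2 \<in> {1..k + 1 - j}" by auto
      then have "X 1 \<union> X 2 \<subseteq> nbhd G v" using nY[OF j(1,2)] by blast
      moreover have "(X 1 \<union> X 2) \<inter> Y k = {}" using UV idx by blast
      ultimately show ?thesis using nH[of v] v by auto
    qed
    show "(X 1 \<union> X 2) \<inter> Y k = {}" using UV idx by blast
    show "M \<subseteq> nbhd T.H u" if "u \<in> ?U \<union> Y k" for u
      using that dY[of u] M(1) MY nH[of u] by auto
    show "Y 1 \<subseteq> nbhd T.H u" if u: "u \<in> ?U \<union> Y k - Y k" for u
      using u dY[of u] Ydisj(1) nH[of u] by auto
    show "M \<subseteq> Y 1" by (rule M)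
    show "Y 1 \<inter> Y (k - 1) = {}" by (rule Ydisj)
    have "card (X 1 \<union> X 2) = card (X 1) + card (X 2)"
      using disj(1)[OF idx(1,2)] finX idx by (simp add: card_Un_disjoint)
    then show "card M \<le> card (X 1 \<union> X 2)" "card (X 1 \<union> X 2) \<le> card (Y 1)"
      using M(2) y1 by simp_all
  qed
qed

end
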